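(* Let $m\ge 1$ be an integer, $\delta\in\mathbb{R}$ and $p,q\in\mathbb{N}=\{0,1,2,\dots\}$ with $p<q$. If $A:\mathcal{S}^p_\delta(\mathbb{R}^m)\to\mathcal{S}^q_\delta(\mathbb{R}^m)$ is a linear map that is $s\ell_{m+1}$-equivariant, i.e. $L_X\circ A=A\circ L_X$ for all $X\in s\ell_{m+1}$, then $A=0$.
   Context: $s\ell_{m+1}$ denotes the Lie subalgebra of the Lie algebra $Vect(\mathbb{R}^m)$ of smooth vector fields on $\mathbb{R}^m$ spanned by $\partial_i$, $x^j\partial_i$ and $x^jE$ ($1\le i,j\le m$), where $E=\sum_i x^i\partial_i$; it is isomorphic to $s\ell(m+1,\mathbb{R})$. $\mathcal{S}^k_\delta(\mathbb{R}^m)$ is the space of smooth symmetric $k$-contravariant tensor fields on $\mathbb{R}^m$ with values in the $\delta$-densities. It is identified with $C_\infty(\mathbb{R}^m,\vee^k\mathbb{R}^m)$, with Lie derivative $L_XP=X.P-\rho(DX)P+\delta\,\mathrm{tr}(DX)P$, where $X.P=\sum_i X^i\partial_iP$, $DX=(\partial_jX^i)$ and $\rho$ is the natural representation of $g\ell(m,\mathbb{R})$ on $\vee^k\mathbb{R}^m$. No continuity or locality is assumed of linear maps. *)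

theory Defs
  imports "HOL-Analysis.Analysis" "HOL-Library.Function_Algebras" "HOL-Library.Multiset"
begin

text \<open>Pointwise scalar multiplication, so that spaces of vector fields and tensor fields are
  real vector spaces in the sense of the library.\<close>

instantiation "fun" :: (type, real_vector) real_vector
begin

definition scaleR_fun :: "real \<Rightarrow> ('a \<Rightarrow> 'b) \<Rightarrow> 'a \<Rightarrow> 'b"
  where "scaleR_fun c f = (\<lambda>x. c *\<^sub>R f x)"

instance
  by standard (auto simp: scaleR_fun_def fun_eq_iff scaleR_add_right scaleR_add_left)

end

primrec Ck :: "nat \<Rightarrow> ('a::real_normed_vector \<Rightarrow> 'b::real_normed_vector) \<Rightarrow> bool" where
  "Ck 0 f \<longleftrightarrow> continuous_on UNIV f"
| "Ck (Suc n) f \<longleftrightarrow> f differentiable_on UNIV \<and> (\<forall>v. Ck n (\<lambda>x. frechet_derivative f (at x) v))"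

definition smooth :: "('a::real_normed_vector \<Rightarrow> 'b::real_normed_vector) \<Rightarrow> bool" where
  "smooth f \<longleftrightarrow> (\<forall>n. Ck n f)"

definition partial :: "'m::finite \<Rightarrow> (real^'m \<Rightarrow> real) \<Rightarrow> real^'m \<Rightarrow> real" where
  "partial i f x = frechet_derivative f (at x) (axis i 1)"

text \<open>An element of the \<open>k\<close>-th symmetric power of \<open>\<real>\<^sup>m\<close> is given by its components
  \<open>T\<close> in the standard basis: \<open>T [i\<^sub>1, \<dots>, i\<^sub>k]\<close> is the component with upper indices
  \<open>i\<^sub>1, \<dots>, i\<^sub>k\<close>. The value on index lists of length other than \<open>k\<close> is fixed to be 0.\<close>

definition sym_tensors :: "nat \<Rightarrow> ('m::finite list \<Rightarrow> real) set" where
  "sym_tensors k = {T. (\<forall>I. length I \<noteq> k \<longrightarrow> T I = 0) \<and> (\<forall>I J. mset I = mset J \<longrightarrow> T I = T J)}"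

text \<open>Natural representation of \<open>gl(m, \<real>)\<close> on contravariant tensors: \<open>B\<close> acts as a derivation
  of the tensor product, i.e. on one upper index at a time.\<close>

definition gl_rep :: "real^'m^'m \<Rightarrow> ('m::finite list \<Rightarrow> real) \<Rightarrow> 'm list \<Rightarrow> real" where
  "gl_rep B T I = (\<Sum>r<length I. \<Sum>j\<in>UNIV. B $ (I ! r) $ j * T (I[r := j]))"

text \<open>Smooth symmetric \<open>k\<close>-contravariant tensor fields with values in the \<open>\<delta>\<close>-densities, in the
  global chart. The underlying vector space does not depend on \<open>\<delta>\<close>; the weight enters only
  through the Lie derivative.\<close>

definition tensor_fields :: "nat \<Rightarrow> (real^'m \<Rightarrow> 'm::finite list \<Rightarrow> real) set" where
  "tensor_fields k = {P. (\<forall>x. P x \<in> sym_tensors k) \<and> (\<forall>I. smooth (\<lambda>x. P x I))}"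

text \<open>The entry of \<open>jacobian X (at x)\<close> in row \<open>i\<close> and column \<open>j\<close> is \<open>\<partial>\<^sub>j X\<^sup>i\<close>.\<close>

definition lie_deriv ::
  "real \<Rightarrow> (real^'m \<Rightarrow> real^'m) \<Rightarrow> (real^'m \<Rightarrow> 'm::finite list \<Rightarrow> real) \<Rightarrow> real^'m \<Rightarrow> 'm list \<Rightarrow> real"
  where
  "lie_deriv \<delta> X P = (\<lambda>x I.
      (\<Sum>i\<in>UNIV. X x $ i * partial i (\<lambda>y. P y I) x)
      - gl_rep (jacobian X (at x)) (P x) I
      + \<delta> * trace (jacobian X (at x)) * P x I)"

definition coord_field :: "'m::finite \<Rightarrow> real^'m \<Rightarrow> real^'m" where
  "coord_field i = (\<lambda>x. axis i 1)"

definition euler_field :: "real^'m::finite \<Rightarrow> real^'m" where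
  "euler_field = (\<lambda>x. \<Sum>i\<in>UNIV. (x $ i) *\<^sub>R coord_field i x)"

definition sl_fields :: "(real^'m::finite \<Rightarrow> real^'m) set" where
  "sl_fields = span
     (range coord_field
      \<union> {(\<lambda>x. (x $ j) *\<^sub>R coord_field i x) | i j. True}
      \<union> {(\<lambda>x. (x $ j) *\<^sub>R euler_field x) | j. True})"

definition linear_between ::
  "'a::real_vector set \<Rightarrow> 'b::real_vector set \<Rightarrow> ('a \<Rightarrow> 'b) \<Rightarrow> bool" where
  "linear_between V W A \<longleftrightarrow> A \<in> V \<rightarrow> W
     \<and> (\<forall>u\<in>V. \<forall>v\<in>V. A (u + v) = A u + A v)
     \<and> (\<forall>c. \<forall>v\<in>V. A (c *\<^sub>R v) = c *\<^sub>R A v)"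

end

theory Submission
  imports Defs
begin

text \<open>Only the dilations \<open>X = \<Sum>\<^sub>i (x\<^sup>i - a\<^sup>i) \<partial>\<^sub>i\<close> are needed. On tensors of degree \<open>k\<close>,
  \<open>L\<^sub>X\<close> is \<open>X + \<delta>m - k\<close>, and \<open>X\<close> vanishes at \<open>a\<close>; hence equivariance, evaluated at \<open>a\<close>, says
  that \<open>A (X.Q + (q - p) Q)\<close> vanishes at \<open>a\<close> for every \<open>Q\<close>. Since \<open>q - p \<ge> 1\<close>, every smooth \<open>P\<close>
  has the form \<open>X.Q + (q - p) Q\<close>, with the smooth solution
  \<open>Q(x) = \<integral>\<^sub>0\<^sup>1 t\<^sup>q\<^sup>-\<^sup>p\<^sup>-\<^sup>1 P(a + t(x - a)) dt\<close>. So \<open>A P\<close> vanishes at every point \<open>a\<close>.\<close>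

lemma has_derivative_frechet:
  assumes "Ck (Suc k) f"
  shows "(f has_derivative frechet_derivative f (at x)) (at x)"
  using assms by (simp add: differentiable_on_def frechet_derivative_works)

lemma Ck_continuous_on: "Ck k f \<Longrightarrow> continuous_on UNIV f"
  by (cases k) (auto intro: differentiable_imp_continuous_on)

lemma Ck_cmult:
  fixes f :: "'a::real_normed_vector \<Rightarrow> real"
  shows "Ck k f \<Longrightarrow> Ck k (\<lambda>x. c * f x)"
proof (induction k arbitrary: f)
  case 0
  then show ?case by (auto intro: continuous_intros)
next
  case (Suc k)
  have D: "((\<lambda>x. c * f x) has_derivative (\<lambda>v. c * frechet_derivative f (at x) v)) (at x)" for x
    by (rule has_derivative_mult_right[OF has_derivative_frechet[OF Suc.prems]])
  then have "frechet_derivative (\<lambda>x. c * f x) (at x) = (\<lambda>v. c * frechet_derivative f (at x) v)" for x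
    by (rule frechet_derivative_at[symmetric])
  then show ?case
    using differentiableI[OF D] Suc by (simp add: differentiable_on_def)
qed

text \<open>The integral solving the radial equation \<open>X.Q + (n + 1) Q = f\<close> for the
  dilation \<open>X\<close> centred at \<open>a\<close>. The exponent stays free because each
  differentiation raises it by one.\<close>

definition radial_mean :: "'a \<Rightarrow> nat \<Rightarrow> ('a::euclidean_space \<Rightarrow> real) \<Rightarrow> 'a \<Rightarrow> real" where
  "radial_mean a n f x = integral {0..1} (\<lambda>t. t ^ n * f (a + t *\<^sub>R (x - a)))"

lemma continuous_radial_mean:
  assumes "continuous_on UNIV f"
  shows "continuous_on UNIV (radial_mean a n f)"
proof -
  have "continuous_on (UNIV \<times> cbox 0 (1::real)) (\<lambda>(x, t). t ^ n * f (a + t *\<^sub>R (x - a)))"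
    unfolding case_prod_beta
    by (intro continuous_intros continuous_on_compose2[OF assms]) auto
  from integral_continuous_on_param[OF this] show ?thesis
    by (simp add: radial_mean_def[abs_def])
qed

lemma radial_integrable:
  fixes f :: "'a::euclidean_space \<Rightarrow> real"
  assumes "continuous_on UNIV f"
  shows "(\<lambda>t::real. t ^ n * f (a + t *\<^sub>R (x - a))) integrable_on {0..1}"
  by (intro integrable_continuous_interval continuous_intros continuous_on_compose2[OF assms])
    (auto intro!: continuous_intros)

text \<open>Differentiation under the integral sign; the inner map
  \<open>x \<mapsto> a + t (x - a)\<close> contributes one more factor \<open>t\<close>, hence the
  exponent \<open>Suc n\<close>.\<close>

lemma radial_mean_has_derivative:
  fixes f :: "'a::euclidean_space \<Rightarrow> real"
  assumes "Ck (Suc k) f"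
  shows "(radial_mean a n f has_derivative
    (\<lambda>v. radial_mean a (Suc n) (\<lambda>y. frechet_derivative f (at y) v) x)) (at x)"
proof -
  \<comment> \<open>The Leibniz rule asks for the derivative of the integrand as a continuous family
    of bounded linear maps, hence the packing by \<open>Blinfun\<close>.\<close>
  define D where "D x t = (t::real) ^ Suc n *\<^sub>R Blinfun (frechet_derivative f (at (a + t *\<^sub>R (x - a))))" for x t
  note df = has_derivative_frechet[OF assms]
  have D: "blinfun_apply (D x t) v = t ^ Suc n * frechet_derivative f (at (a + t *\<^sub>R (x - a))) v" for x t v
    unfolding D_def scaleR_blinfun.rep_eq
    by (simp add: bounded_linear_Blinfun_apply[OF has_derivative_bounded_linear[OF df]])
  have cf: "continuous_on UNIV f" and cd: "continuous_on UNIV (\<lambda>y. frechet_derivative f (at y) v)" for v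
    using assms Ck_continuous_on[OF assms] Ck_continuous_on[of k] by auto
  \<comment> \<open>In finite dimension, continuity in operator norm follows from continuity of the
    values on basis vectors, which \<open>cd\<close> supplies.\<close>
  have contD: "continuous_on (UNIV \<times> cbox 0 1) (\<lambda>(x, t). D x t)"
    unfolding case_prod_beta
    by (intro continuous_on_blinfun_componentwise, unfold D)
      (intro continuous_intros continuous_on_compose2[OF cd]; auto)
  have "((\<lambda>x. integral (cbox 0 1) (\<lambda>t. t ^ n * f (a + t *\<^sub>R (x - a)))) has_derivative
    blinfun_apply (integral (cbox 0 1) (D x))) (at x within UNIV)"
  proof (rule leibniz_rule)
    show "((\<lambda>x. t ^ n * f (a + t *\<^sub>R (x - a))) has_derivative blinfun_apply (D x t)) (at x within UNIV)" for x t
      by (rule has_derivative_eq_rhs[OF has_derivative_mult_right[OF has_derivative_compose[OF _ df]]])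
        (auto intro!: derivative_eq_intros simp: D fun_eq_iff
          linear_scale[OF has_derivative_linear[OF df]])
    show "(\<lambda>t. t ^ n * f (a + t *\<^sub>R (x - a))) integrable_on cbox 0 1" for x
      using radial_integrable[OF cf] by simp
  qed (use contD in auto)
  moreover have "D x integrable_on cbox 0 1"
    by (intro integrable_continuous continuous_on_compose2[OF contD, of _ "\<lambda>t. (x, t)", simplified])
      (auto intro!: continuous_intros)
  then have "blinfun_apply (integral (cbox 0 1) (D x)) = (\<lambda>v. integral (cbox 0 1) (\<lambda>t. D x t v))"
    by (intro ext blinfun_apply_integral)
  ultimately show ?thesis
    by (simp add: radial_mean_def[abs_def] D)
qed

text \<open>A directional derivative of a radial mean is again a radial mean, of a function of class
  one lower and with exponent one higher; so the induction runs over all \<open>f\<close> and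
  \<open>n\<close>.\<close>

lemma Ck_radial_mean:
  fixes f :: "'a::euclidean_space \<Rightarrow> real"
  shows "Ck k f \<Longrightarrow> Ck k (radial_mean a n f)"
proof (induction k arbitrary: f n)
  case 0
  then show ?case by (simp add: continuous_radial_mean)
next
  case (Suc k)
  note D = radial_mean_has_derivative[OF Suc.prems, of a n]
  have "frechet_derivative (radial_mean a n f) (at x) v
    = radial_mean a (Suc n) (\<lambda>y. frechet_derivative f (at y) v) x" for x v
    by (simp add: frechet_derivative_at[OF D, symmetric])
  moreover have "Ck k (radial_mean a (Suc n) (\<lambda>y. frechet_derivative f (at y) v))" for v
    using Suc by simp
  ultimately show ?case
    using differentiableI[OF D] by (simp add: differentiable_on_def)
qed

text \<open>Integrate the \<open>t\<close>-derivative of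
  \<open>t ^ Suc n * f (a + t (x - a))\<close> over the unit interval in two ways.\<close>

lemma radial_mean_euler:
  fixes f :: "'a::euclidean_space \<Rightarrow> real"
  assumes "Ck (Suc k) f"
  shows "frechet_derivative (radial_mean a n f) (at x) (x - a) + real (Suc n) * radial_mean a n f x = f x"
proof -
  let ?g = "\<lambda>t::real. a + t *\<^sub>R (x - a)"
  let ?D = "\<lambda>t. frechet_derivative f (at (?g t)) (x - a)"
  note df = has_derivative_frechet[OF assms]
  have cf: "continuous_on UNIV f" and cd: "continuous_on UNIV (\<lambda>y. frechet_derivative f (at y) (x - a))"
    using assms Ck_continuous_on[OF assms] Ck_continuous_on[of k] by auto
  have "((\<lambda>t. f (?g t)) has_vector_derivative ?D t) (at t within {0..1})" for t
    unfolding has_vector_derivative_def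
    by (rule has_derivative_eq_rhs[OF has_derivative_compose[OF _ df]])
      (auto intro!: derivative_eq_intros simp: fun_eq_iff linear_scale[OF has_derivative_linear[OF df]])
  then have "((\<lambda>t. f (?g t)) has_real_derivative ?D t) (at t within {0..1})" for t
    by (simp add: has_real_derivative_iff_has_vector_derivative)
  then have "((\<lambda>t. t ^ Suc n * f (?g t)) has_real_derivative
      t ^ Suc n * ?D t + real (Suc n) * (t ^ n * f (?g t))) (at t within {0..1})" for t
    by (rule DERIV_cong[OF DERIV_mult[OF DERIV_pow[of "Suc n"]]]) simp
  \<comment> \<open>By endpoints: \<open>t = 1\<close> gives \<open>f x\<close>, and
    \<open>t = 0\<close> gives 0 because the exponent \<open>Suc n\<close> is positive.\<close>
  then have "((\<lambda>t. t ^ Suc n * ?D t + real (Suc n) * (t ^ n * f (?g t))) has_integral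
      1 ^ Suc n * f (?g 1) - 0 ^ Suc n * f (?g 0)) {0..1}"
    by (intro fundamental_theorem_of_calculus)
      (auto simp: has_real_derivative_iff_has_vector_derivative)
  \<comment> \<open>Term by term: the first summand integrates to the derivative of the radial mean
    in direction \<open>x - a\<close>.\<close>
  moreover have "((\<lambda>t. t ^ Suc n * ?D t + real (Suc n) * (t ^ n * f (?g t))) has_integral
      radial_mean a (Suc n) (\<lambda>y. frechet_derivative f (at y) (x - a)) x
      + real (Suc n) * radial_mean a n f x) {0..1}"
    unfolding radial_mean_def
    by (intro has_integral_add has_integral_mult_right integrable_integral
        radial_integrable[OF cf] radial_integrable[OF cd])
  ultimately have "radial_mean a (Suc n) (\<lambda>y. frechet_derivative f (at y) (x - a)) x
      + real (Suc n) * radial_mean a n f x = f x"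
    by (auto dest: has_integral_unique)
  then show ?thesis
    by (simp add: frechet_derivative_at[OF radial_mean_has_derivative[OF assms], symmetric])
qed

lemma sum_partial:
  fixes f :: "real^'m::finite \<Rightarrow> real"
  assumes "f differentiable at x"
  shows "(\<Sum>i\<in>UNIV. v $ i * partial i f x) = frechet_derivative f (at x) v"
proof -
  have l: "linear (frechet_derivative f (at x))"
    by (rule linear_frechet_derivative[OF assms])
  have "frechet_derivative f (at x) v = frechet_derivative f (at x) (\<Sum>i\<in>UNIV. v $ i *\<^sub>R axis i 1)"
    by (simp add: basis_expansion scalar_mult_eq_scaleR[symmetric])
  then show ?thesis
    by (simp add: partial_def linear_sum[OF l] linear_scale[OF l])
qed

lemma gl_rep_id: "gl_rep (mat 1) T I = real (length I) * T I"
proof -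
  have "(\<Sum>j\<in>UNIV. mat 1 $ (I ! r) $ j * T (I[r := j])) = T I" for r
  proof -
    have "(\<Sum>j\<in>UNIV. mat 1 $ (I ! r) $ j * T (I[r := j]))
        = (\<Sum>j\<in>UNIV. if I ! r = j then T (I[r := j]) else 0)"
      by (rule sum.cong) (auto simp: mat_def)
    then show ?thesis by simp
  qed
  then show ?thesis by (simp add: gl_rep_def)
qed

text \<open>The sum of the diagonal linear generators is the Euler field; subtracting a constant
  field moves its zero to \<open>a\<close>.\<close>

lemma dilation_field_in_sl_fields: "(\<lambda>x::real^'m::finite. x - a) \<in> sl_fields"
proof -
  have sum_apply: "(\<Sum>i\<in>S. F i) x = (\<Sum>i\<in>S. F i x)"
    for S :: "'m set" and F :: "'m \<Rightarrow> real^'m \<Rightarrow> real^'m" and x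
    by (induction S rule: infinite_finite_induct) auto
  have "(\<lambda>x. x - a) = (\<Sum>i\<in>UNIV. (\<lambda>x. (x $ i) *\<^sub>R coord_field i x)) - (\<Sum>i\<in>UNIV. (a $ i) *\<^sub>R coord_field i)"
    by (simp add: fun_eq_iff sum_apply scaleR_fun_def coord_field_def basis_expansion
        scalar_mult_eq_scaleR[symmetric])
  also have "\<dots> \<in> sl_fields"
    unfolding sl_fields_def
    by (intro span_diff span_sum span_scale span_base) auto
  finally show ?thesis .
qed

text \<open>The Jacobian is the identity, which has trace \<open>m\<close> and acts on degree
  \<open>k\<close> as multiplication by \<open>k\<close>.\<close>

lemma lie_deriv_dilation:
  fixes P :: "real^'m::finite \<Rightarrow> 'm list \<Rightarrow> real"
  assumes "P \<in> tensor_fields k"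
  shows "lie_deriv \<delta> (\<lambda>y. y - a) P x I
    = frechet_derivative (\<lambda>y. P y I) (at x) (x - a) + (\<delta> * CARD('m) - k) * P x I"
proof -
  have "Ck (Suc 0) (\<lambda>y. P y I)"
    using assms by (simp add: tensor_fields_def smooth_def del: Ck.simps)
  then have d: "(\<lambda>y. P y I) differentiable at x"
    by (simp add: differentiable_on_def)
  have "((\<lambda>y. y - a) has_derivative (\<lambda>v. v)) (at x)"
    by (auto intro!: derivative_eq_intros)
  then have "jacobian (\<lambda>y. y - a) (at x) = mat 1"
    by (simp add: jacobian_def frechet_derivative_at[symmetric] matrix_id_mat_1[unfolded id_def])
  then have "lie_deriv \<delta> (\<lambda>y. y - a) P x I
    = frechet_derivative (\<lambda>y. P y I) (at x) (x - a) - length I * P x I + \<delta> * CARD('m) * P x I"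
    by (simp only: lie_deriv_def gl_rep_id trace_I sum_partial[OF d])
  \<comment> \<open>\<open>gl_rep_id\<close> produces \<open>length I\<close>; it may be replaced by
    \<open>k\<close> since components at other lengths are 0.\<close>
  moreover have "length I = k \<or> P x I = 0"
    using assms unfolding tensor_fields_def sym_tensors_def by blast
  ultimately show ?thesis
    by (auto simp: algebra_simps)
qed

theorem theorem7p3:
  fixes \<delta> :: real and p q :: nat
    and A :: "(real^'m \<Rightarrow> 'm::finite list \<Rightarrow> real) \<Rightarrow> (real^'m \<Rightarrow> 'm list \<Rightarrow> real)"
  assumes "p < q"
    and "linear_between (tensor_fields p) (tensor_fields q) A"
    and "\<And>X P. X \<in> sl_fields \<Longrightarrow> P \<in> tensor_fields p \<Longrightarrow>
           lie_deriv \<delta> X (A P) = A (lie_deriv \<delta> X P)"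
  shows "\<forall>P\<in>tensor_fields p. A P = 0"
proof
  fix P :: "real^'m \<Rightarrow> 'm list \<Rightarrow> real"
  assume P: "P \<in> tensor_fields p"
  have "A P a I = 0" for a I
  proof -
    \<comment> \<open>Chosen so that the coefficient \<open>Suc n\<close> of the radial equation is
      \<open>q - p\<close>; here \<open>p < q\<close> enters.\<close>
    define n where "n = q - p - 1"
    have n: "real (Suc n) = real q - real p"
      using \<open>p < q\<close> by (simp add: n_def)
    define Q where "Q x J = radial_mean a n (\<lambda>y. P y J) x" for x J
    \<comment> \<open>The scalar part of the Lie derivative in degree \<open>q\<close>; in degree
      \<open>p\<close> it is \<open>c + (q - p)\<close>.\<close>
    define c where "c = \<delta> * CARD('m) - q"
    have smooth_P: "smooth (\<lambda>x. P x J)" and P_zero: "length J \<noteq> p \<Longrightarrow> P x J = 0"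
      and P_sym: "mset J = mset K \<Longrightarrow> P x J = P x K" for x J K
      using P unfolding tensor_fields_def sym_tensors_def mem_Collect_eq by blast+
    have Q_sym: "Q x J = Q x K" if "mset J = mset K" for x J K
      unfolding Q_def by (subst P_sym[OF that]) (rule refl)
    have Q: "Q \<in> tensor_fields p"
      unfolding tensor_fields_def sym_tensors_def mem_Collect_eq
    proof (intro conjI allI impI)
      show "Q x J = 0" if "length J \<noteq> p" for x J
        using that by (simp add: Q_def radial_mean_def P_zero)
      show "smooth (\<lambda>x. Q x J)" for J
        using smooth_P[of J] unfolding Q_def smooth_def by (blast intro: Ck_radial_mean)
    qed (rule Q_sym)
    \<comment> \<open>\<open>A\<close> is additive only on tensor fields, so both summands of
      \<open>P + c Q\<close> must be such fields.\<close>
    have cQ: "c *\<^sub>R Q \<in> tensor_fields p"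
      using Q unfolding tensor_fields_def sym_tensors_def mem_Collect_eq scaleR_fun_def smooth_def
        real_scaleR_def
      by (intro conjI allI impI arg_cong[of _ _ "(*) c"] Ck_cmult) (simp, blast+)
    have "frechet_derivative (\<lambda>y. Q y J) (at x) (x - a) + (real q - real p) * Q x J = P x J" for x J
      using radial_mean_euler[of 0 "\<lambda>y. P y J" a n x] smooth_P[of J]
      by (simp add: Q_def n smooth_def del: Ck.simps of_nat_Suc)
    then have "lie_deriv \<delta> (\<lambda>y. y - a) Q = P + c *\<^sub>R Q"
      by (simp add: fun_eq_iff lie_deriv_dilation[OF Q] scaleR_fun_def c_def algebra_simps)
    then have "lie_deriv \<delta> (\<lambda>y. y - a) (A Q) = A (P + c *\<^sub>R Q)"
      using assms(3)[OF dilation_field_in_sl_fields Q] by metis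
    also have "\<dots> = A P + c *\<^sub>R A Q"
      using assms(2) P Q cQ by (simp add: linear_between_def)
    finally have "lie_deriv \<delta> (\<lambda>y. y - a) (A Q) a I = A P a I + c * A Q a I"
      by (simp add: scaleR_fun_def)
    moreover have AQ: "A Q \<in> tensor_fields q"
      using assms(2) Q by (auto simp: linear_between_def)
    \<comment> \<open>At \<open>a\<close> the derivative is applied to \<open>a - a = 0\<close>, so
      the left side reduces to \<open>c * A Q a I\<close>; cancelling it leaves
      \<open>A P a I = 0\<close>.\<close>
    moreover have "linear (frechet_derivative (\<lambda>y. A Q y I) (at a))"
      using AQ unfolding tensor_fields_def smooth_def
      by (intro has_derivative_linear[OF has_derivative_frechet[of 0]]) blast
    ultimately show ?thesis
      by (simp add: lie_deriv_dilation c_def linear_0)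
  qed
  then show "A P = 0"
    by (simp add: fun_eq_iff)
qed

end
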